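(* For every integer $k\ge 2$, $\mathfrak{b}(\mathbf{R}_\forall^{\mathsf{col},k})=\mathfrak{b}$ and $\mathfrak{d}(\mathbf{R}_\forall^{\mathsf{col},k})=\mathfrak{d}$, and $\mathfrak{b}(\mathbf{R}_\exists^{\mathsf{col},k})=\mathfrak{d}$ and $\mathfrak{d}(\mathbf{R}_\exists^{\mathsf{col},k})=\mathfrak{b}$.
   Context: A relational system $\mathbf{R}=\langle X,Y,\sqsubset\rangle$ consists of two non-empty sets $X,Y$ and a relation $\sqsubset$ between elements of $X$ and elements of $Y$. A set $F\subseteq X$ is $\mathbf{R}$-bounded if $\exists y\in Y\,\forall x\in F\; x\sqsubset y$, and $\mathbf{R}$-unbounded otherwise; $E\subseteq Y$ is $\mathbf{R}$-dominating if $\forall x\in X\,\exists y\in E\; x\sqsubset y$. Put $\mathfrak{b}(\mathbf{R})=\min\{|F|: F\subseteq X \text{ is } \mathbf{R}\text{-unbounded}\}$ and $\mathfrak{d}(\mathbf{R})=\min\{|D|: D\subseteq Y\text{ is }\mathbf{R}\text{-dominating}\}$. $\omega^{\uparrow\omega}$ is the set of strictly increasing functions $\omega\to\omega$; $[a,b)=\{m\in\omega: a\le m<b\}$; $\forall^\infty n$ means "for all but finitely many $n\in\omega$", $\exists^\infty n$ means "for infinitely many $n\in\omega$". $\mathfrak{b}$ and $\mathfrak{d}$ denote $\mathfrak{b}(\mathbf{D})$ and $\mathfrak{d}(\mathbf{D})$ for $\mathbf{D}=\langle\omega^{\uparrow\omega},\omega^{\uparrow\omega},\le^*\rangle$, where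 $x\le^* y$ means $\forall^\infty n\; x(n)\le y(n)$. $\mathrm{Part}(\omega)$ is the set of all infinite partitions $\mathcal{P}=\{X_i:i\in\omega\}$ of $\omega$ into (non-empty, pairwise disjoint) finite sets. For $\iota\in\{\forall,\exists\}$, $\mathbf{R}_\iota^{\mathsf{col},k}=\langle\omega^{\uparrow\omega},\mathrm{Part}(\omega),\sqsubset_\iota^{\mathsf{col},k}\rangle$, where $f\sqsubset_\iota^{\mathsf{col},k}\mathcal{P}$ iff $\iota^\infty n\; |\{i\in\omega:[f(n),f(n+1))\cap X_i\ne\emptyset\}|\le k$. *)

theory Defs
  imports "HOL-Library.Disjoint_Sets" "HOL-Library.Infinite_Set"
begin

unbundle cardinal_syntax

record ('a, 'b) rel_sys =
  questions :: "'a set"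
  answers :: "'b set"
  related :: "'a \<Rightarrow> 'b \<Rightarrow> bool"

definition relational_system :: "('a, 'b) rel_sys \<Rightarrow> bool" where
  "relational_system R \<longleftrightarrow> questions R \<noteq> {} \<and> answers R \<noteq> {}"

definition bounded_in :: "('a, 'b) rel_sys \<Rightarrow> 'a set \<Rightarrow> bool" where
  "bounded_in R F \<longleftrightarrow> F \<subseteq> questions R \<and> (\<exists>y\<in>answers R. \<forall>x\<in>F. related R x y)"

definition unbounded_in :: "('a, 'b) rel_sys \<Rightarrow> 'a set \<Rightarrow> bool" where
  "unbounded_in R F \<longleftrightarrow> F \<subseteq> questions R \<and> \<not> bounded_in R F"

definition dominating_in :: "('a, 'b) rel_sys \<Rightarrow> 'b set \<Rightarrow> bool" where
  "dominating_in R E \<longleftrightarrow> E \<subseteq> answers R \<and> (\<forall>x\<in>questions R. \<exists>y\<in>E. related R x y)"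

text \<open>Cardinals are cardinal well-orders, determined only up to order isomorphism; accordingly
  equality of cardinals is stated with \<open>=o\<close>. The minimum of the cardinalities of a family of sets
  is meaningful only for a nonempty family (lemma \<open>min_card_of\<close>); for the empty
  family the value is arbitrary.\<close>

definition min_card :: "'a set set \<Rightarrow> 'a rel" where
  "min_card S = (SOME r. r \<in> card_of ` S \<and> (\<forall>r'\<in>card_of ` S. r \<le>o r'))"

definition bounding_number :: "('a, 'b) rel_sys \<Rightarrow> 'a rel" where
  "bounding_number R = min_card {F. unbounded_in R F}"

definition dominating_number :: "('a, 'b) rel_sys \<Rightarrow> 'b rel" where
  "dominating_number R = min_card {E. dominating_in R E}"

definition increasing_seqs :: "(nat \<Rightarrow> nat) set" where
  "increasing_seqs = {f. strict_mono f}"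

definition dom_sys :: "(nat \<Rightarrow> nat, nat \<Rightarrow> nat) rel_sys" where
  "dom_sys = \<lparr>questions = increasing_seqs, answers = increasing_seqs,
     related = (\<lambda>x y. \<forall>\<^sub>\<infinity>n. x n \<le> y n)\<rparr>"

definition finite_block_partitions :: "nat set set set" where
  "finite_block_partitions = {P. partition_on UNIV P \<and> infinite P \<and> (\<forall>X\<in>P. finite X)}"

text \<open>Blocks of a partition are nonempty and pairwise disjoint, so counting the indices \<open>i\<close> with
  \<open>[f(n), f(n+1)) \<inter> X\<^sub>i \<noteq> {}\<close> in an enumeration is the same as counting blocks. The counted
  set is finite (lemma \<open>finite_blocks_met\<close>), so \<open>card\<close> is its true cardinality.\<close>

definition blocks_met :: "(nat \<Rightarrow> nat) \<Rightarrow> nat set set \<Rightarrow> nat \<Rightarrow> nat set set" where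
  "blocks_met f P n = {X\<in>P. {f n..<f (n + 1)} \<inter> X \<noteq> {}}"

definition col_all_sys :: "nat \<Rightarrow> (nat \<Rightarrow> nat, nat set set) rel_sys" where
  "col_all_sys k = \<lparr>questions = increasing_seqs, answers = finite_block_partitions,
     related = (\<lambda>f P. \<forall>\<^sub>\<infinity>n. card (blocks_met f P n) \<le> k)\<rparr>"

definition col_ex_sys :: "nat \<Rightarrow> (nat \<Rightarrow> nat, nat set set) rel_sys" where
  "col_ex_sys k = \<lparr>questions = increasing_seqs, answers = finite_block_partitions,
     related = (\<lambda>f P. \<exists>\<^sub>\<infinity>n. card (blocks_met f P n) \<le> k)\<rparr>"

lemma min_card_of:
  assumes "S \<noteq> {}"
  shows "\<exists>F\<in>S. min_card S = |F|" and "\<And>F. F \<in> S \<Longrightarrow> min_card S \<le>o |F|"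
proof -
  have "\<exists>r\<in>card_of ` S. \<forall>r'\<in>card_of ` S. r \<le>o r'"
  proof (rule exists_minim_Well_order)
    show "card_of ` S \<noteq> {}" using assms by simp
    show "\<forall>r\<in>card_of ` S. Well_order r" by (blast intro: card_of_Well_order)
  qed
  then have "\<exists>r. r \<in> card_of ` S \<and> (\<forall>r'\<in>card_of ` S. r \<le>o r')"
    by (simp only: Bex_def)
  then have min: "min_card S \<in> card_of ` S \<and> (\<forall>r'\<in>card_of ` S. min_card S \<le>o r')"
    unfolding min_card_def by (rule someI_ex)
  show "\<exists>F\<in>S. min_card S = |F|" using min by (simp only: image_iff)
  show "min_card S \<le>o |F|" if "F \<in> S" for F
    using min that by (simp only: ball_simps)
qed

lemma finite_blocks_met:
  assumes "P \<in> finite_block_partitions"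
  shows "finite (blocks_met f P n)"
proof -
  have disj: "X = Y" if "X \<in> P" "Y \<in> P" "m \<in> X" "m \<in> Y" for X Y m
    using assms that unfolding finite_block_partitions_def partition_on_def disjoint_def by blast
  have "blocks_met f P n \<subseteq> (\<lambda>m. THE X. X \<in> P \<and> m \<in> X) ` {f n..<f (n + 1)}"
  proof
    fix X assume "X \<in> blocks_met f P n"
    then obtain m where "X \<in> P" "m \<in> X" "m \<in> {f n..<f (n + 1)}"
      unfolding blocks_met_def by blast
    moreover from this have "(THE X. X \<in> P \<and> m \<in> X) = X"
      using disj by (intro the_equality) blast+
    ultimately show "X \<in> (\<lambda>m. THE X. X \<in> P \<and> m \<in> X) ` {f n..<f (n + 1)}" by force
  qed
  then show ?thesis by (rule finite_subset) simp
qed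

lemma id_increasing: "id \<in> increasing_seqs"
  by (simp add: increasing_seqs_def strict_mono_def)

lemma singletons_partition: "range (\<lambda>n. {n}) \<in> finite_block_partitions"
proof -
  have "infinite (range (\<lambda>n::nat. {n}))"
    by (rule range_inj_infinite) (simp add: inj_on_def)
  then show ?thesis
    by (auto simp: finite_block_partitions_def partition_on_def disjoint_def)
qed

lemma relational_systems:
  "relational_system dom_sys"
  "relational_system (col_all_sys k)"
  "relational_system (col_ex_sys k)"
  using id_increasing singletons_partition
  by (auto simp: relational_system_def dom_sys_def col_all_sys_def col_ex_sys_def)

text \<open>The lemmas below show that the families whose minimal cardinality is taken are nonempty
  (for the block-counting systems with \<open>k \<ge> 1\<close>), so the minima are genuine.\<close>

lemma dom_sys_unbounded: "unbounded_in dom_sys increasing_seqs"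
proof -
  have "\<exists>x\<in>increasing_seqs. \<not> (\<forall>\<^sub>\<infinity>n. x n \<le> y n)" if "y \<in> increasing_seqs" for y
    using that by (intro bexI[of _ "Suc \<circ> y"]) (auto simp: increasing_seqs_def strict_mono_def)
  then show ?thesis
    by (auto simp: unbounded_in_def bounded_in_def dom_sys_def)
qed

lemma dom_sys_dominating: "dominating_in dom_sys increasing_seqs"
proof -
  have "\<exists>y\<in>increasing_seqs. \<forall>\<^sub>\<infinity>n. x n \<le> y n" if "x \<in> increasing_seqs" for x
    using that by (intro bexI[of _ x]) auto
  then show ?thesis by (auto simp: dominating_in_def dom_sys_def)
qed

lemma interval_partition:
  assumes "f \<in> increasing_seqs"
  shows "\<exists>P\<in>finite_block_partitions. \<forall>\<^sub>\<infinity>n. card (blocks_met f P n) \<le> 1"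
proof -
  define g where "g i = (if i = 0 then 0 else f i)" for i
  define I where "I i = {g i..<g (Suc i)}" for i
  have f: "strict_mono f" using assms by (simp add: increasing_seqs_def)
  have g: "strict_mono g"
    unfolding strict_mono_Suc_iff
  proof
    fix n show "g n < g (Suc n)"
      using strict_mono_less[OF f, of n "Suc n"] strict_mono_less[OF f, of 0 "Suc n"]
      by (auto simp: g_def)
  qed
  have uniq: "i = j" if "m \<in> I i" "m \<in> I j" for i j m
  proof (rule ccontr)
    assume "i \<noteq> j"
    then consider "Suc i \<le> j" | "Suc j \<le> i" by linarith
    then show False
      using that strict_mono_less_eq[OF g, of "Suc i" j] strict_mono_less_eq[OF g, of "Suc j" i]
      by cases (auto simp: I_def)
  qed
  have ne: "g i \<in> I i" for i
    using strict_mono_less[OF g, of i "Suc i"] by (simp add: I_def)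
  have cover: "\<exists>i. m \<in> I i" for m
  proof -
    have "m < g (Suc m)"
      using strict_mono_imp_increasing[OF g, of "Suc m"] by simp
    then have ex: "\<exists>j. m < g (Suc j)" by blast
    define j where "j = (LEAST j. m < g (Suc j))"
    have "m < g (Suc j)" unfolding j_def by (rule LeastI_ex[OF ex])
    moreover have "g j \<le> m"
    proof (cases j)
      case 0 then show ?thesis by (simp add: g_def)
    next
      case (Suc i)
      then have "\<not> m < g (Suc i)"
        using not_less_Least[of i "\<lambda>j. m < g (Suc j)"] unfolding j_def by simp
      then show ?thesis using Suc by simp
    qed
    ultimately show ?thesis by (auto simp: I_def)
  qed
  have "inj I" using uniq ne by (metis injI)
  then have "infinite (range I)" by (rule range_inj_infinite)
  moreover have "partition_on UNIV (range I)"
  proof (rule partition_onI)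
    show "\<Union> (range I) = UNIV" using cover by blast
    show "disjnt p q" if "p \<in> range I" "q \<in> range I" "p \<noteq> q" for p q
    proof -
      obtain i j where ij: "p = I i" "q = I j" using \<open>p \<in> range I\<close> \<open>q \<in> range I\<close> by auto
      then have "i \<noteq> j" using \<open>p \<noteq> q\<close> by auto
      then show ?thesis using uniq[of _ i j] unfolding ij disjnt_iff by metis
    qed
    show "{} \<notin> range I" using ne by (metis empty_iff rangeE)
  qed
  moreover have "\<forall>X\<in>range I. finite X" by (auto simp: I_def)
  ultimately have "range I \<in> finite_block_partitions"
    by (simp add: finite_block_partitions_def)
  moreover have "card (blocks_met f (range I) n) \<le> 1" if "n \<ge> 1" for n
  proof -
    have met: "{f n..<f (n + 1)} = I n" using that by (auto simp: I_def g_def)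
    have "blocks_met f (range I) n \<subseteq> {I n}"
    proof
      fix X assume X: "X \<in> blocks_met f (range I) n"
      then obtain i where i: "X = I i" by (auto simp: blocks_met_def)
      have "I n \<inter> X \<noteq> {}" using X by (simp add: blocks_met_def flip: met)
      then obtain m where "m \<in> I n" "m \<in> X" by blast
      then show "X \<in> {I n}" using uniq[of m i n] i by simp
    qed
    then have "card (blocks_met f (range I) n) \<le> card {I n}" by (intro card_mono) simp
    then show ?thesis by simp
  qed
  then have "\<forall>\<^sub>\<infinity>n. card (blocks_met f (range I) n) \<le> 1"
    by (auto simp: MOST_nat_le)
  ultimately show ?thesis by blast
qed

lemma many_blocks:
  assumes "P \<in> finite_block_partitions"
  shows "\<exists>f\<in>increasing_seqs. \<forall>n. card (blocks_met f P n) > k"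
proof -
  have P: "infinite P" "\<And>X. X \<in> P \<Longrightarrow> finite X"
    using assms by (auto simp: finite_block_partitions_def)
  have step: "\<exists>b>a. card {X\<in>P. {a..<b} \<inter> X \<noteq> {}} > k" for a
  proof -
    have "finite {X\<in>P. X \<subseteq> {..<a}}"
      by (rule finite_subset[of _ "Pow {..<a}"]) auto
    then have "infinite (P - {X\<in>P. X \<subseteq> {..<a}})" using P(1) by (simp add: Diff_infinite_finite)
    then obtain T where T: "T \<subseteq> P - {X\<in>P. X \<subseteq> {..<a}}" "finite T" "card T = Suc k"
      by (meson infinite_arbitrarily_large)
    have fin: "finite (\<Union>T)" using T P(2) by (intro finite_Union) auto
    define b where "b = Suc (a + Max (insert 0 (\<Union>T)))"
    have bnd: "m < b" if "m \<in> X" "X \<in> T" for m X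
    proof -
      have "m \<le> Max (insert 0 (\<Union>T))" using that fin by (intro Max_ge) auto
      then show ?thesis by (simp add: b_def)
    qed
    have sub: "T \<subseteq> {X\<in>P. {a..<b} \<inter> X \<noteq> {}}"
    proof
      fix X assume X: "X \<in> T"
      then have "X \<in> P" "\<not> X \<subseteq> {..<a}" using T(1) by auto
      then obtain m where "m \<in> X" "a \<le> m" by (auto simp: subset_eq not_less)
      then have "m \<in> {a..<b} \<inter> X" using bnd X by simp
      then show "X \<in> {X\<in>P. {a..<b} \<inter> X \<noteq> {}}" using \<open>X \<in> P\<close> by blast
    qed
    have "a < b" by (simp add: b_def)
    have "finite {X\<in>P. {a..<b} \<inter> X \<noteq> {}}"
      using finite_blocks_met[OF assms, of "\<lambda>n. if n = 0 then a else b" 0] by (simp add: blocks_met_def)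
    then show ?thesis using card_mono[OF _ sub] T(3) \<open>a < b\<close> by (intro exI[of _ b]) auto
  qed
  obtain f where f: "\<And>n. f (Suc n) > f n \<and> card {X\<in>P. {f n..<f (Suc n)} \<inter> X \<noteq> {}} > k"
    using dependent_nat_choice[of "\<lambda>_ _. True"
        "\<lambda>_ a b. b > a \<and> card {X\<in>P. {a..<b} \<inter> X \<noteq> {}} > k"] step by auto
  then have "f \<in> increasing_seqs" by (simp add: increasing_seqs_def strict_mono_Suc_iff)
  then show ?thesis using f by (auto simp: blocks_met_def)
qed

lemma col_sys_unbounded:
  "unbounded_in (col_all_sys k) increasing_seqs"
  "unbounded_in (col_ex_sys k) increasing_seqs"
proof -
  have *: "\<exists>f\<in>increasing_seqs. \<not> (\<exists>\<^sub>\<infinity>n. card (blocks_met f P n) \<le> k)"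
    if P: "P \<in> finite_block_partitions" for P
  proof -
    obtain f where "f \<in> increasing_seqs" "\<forall>n. \<not> card (blocks_met f P n) \<le> k"
      using many_blocks[OF P, of k] by (auto simp: not_le)
    then show ?thesis by (intro bexI[of _ f]) auto
  qed
  then show "unbounded_in (col_ex_sys k) increasing_seqs"
    by (auto simp: unbounded_in_def bounded_in_def col_ex_sys_def)
  have "\<exists>f\<in>increasing_seqs. \<not> (\<forall>\<^sub>\<infinity>n. card (blocks_met f P n) \<le> k)"
    if "P \<in> finite_block_partitions" for P
    using *[OF that] MOST_INFM[OF infinite_UNIV_nat] by blast
  then show "unbounded_in (col_all_sys k) increasing_seqs"
    by (auto simp: unbounded_in_def bounded_in_def col_all_sys_def)
qed

lemma col_sys_dominating:
  assumes "k \<ge> 1"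
  shows "dominating_in (col_all_sys k) finite_block_partitions"
    and "dominating_in (col_ex_sys k) finite_block_partitions"
proof -
  have *: "\<exists>P\<in>finite_block_partitions. \<forall>\<^sub>\<infinity>n. card (blocks_met f P n) \<le> k"
    if f: "f \<in> increasing_seqs" for f
  proof -
    obtain P where P: "P \<in> finite_block_partitions" "\<forall>\<^sub>\<infinity>n. card (blocks_met f P n) \<le> 1"
      using interval_partition[OF f] by blast
    have "\<forall>\<^sub>\<infinity>n. card (blocks_met f P n) \<le> k"
      using P(2) by (rule MOST_mono) (use assms in linarith)
    then show ?thesis using P(1) by blast
  qed
  then show "dominating_in (col_all_sys k) finite_block_partitions"
    by (auto simp: dominating_in_def col_all_sys_def)
  have "\<exists>P\<in>finite_block_partitions. \<exists>\<^sub>\<infinity>n. card (blocks_met f P n) \<le> k"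
    if "f \<in> increasing_seqs" for f
    using *[OF that] MOST_INFM[OF infinite_UNIV_nat] by blast
  then show "dominating_in (col_ex_sys k) finite_block_partitions"
    by (auto simp: dominating_in_def col_ex_sys_def)
qed

end

theory Submission
  imports Defs
begin

text \<open>
  The equalities come from Tukey equivalences: \<open>col_all_sys k\<close> is Tukey equivalent to \<open>dom_sys\<close>, and
  \<open>col_ex_sys k\<close> to the dual of \<open>dom_sys\<close>, in which \<open>x\<close> is answered by those \<open>y\<close> that it does not
  eventually dominate. Passing to the dual exchanges unbounded with dominating families, hence
  the bounding with the dominating number.

  Both translations rest on the sequence \<open>0, x(0) + 1, x(x(0) + 1) + 1, \<dots>\<close> attached to an increasing
  \<open>x\<close>, called \<open>orbit x\<close> below: each point of the orbit lies just beyond the value of \<open>x\<close> at the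
  preceding point.

  From dominating functions to partitions: cut \<open>\<omega>\<close> at the orbit of \<open>y\<close>. Whenever
  \<open>f(n + 1) \<le> y(n)\<close>, the interval \<open>[f(n), f(n + 1))\<close> lies in \<open>[n, y(n))\<close>, and such an interval stays
  within two consecutive blocks, because \<open>y\<close> sends each cut below the next cut
  (\<open>blocks_met_orbit_partition\<close>). Since this is an implication for each single \<open>n\<close>, it serves
  ``for almost all'' and ``for infinitely many'' alike. This is where \<open>k \<ge> 2\<close> enters.

  From partitions to dominating functions: to \<open>P\<close> attach an increasing \<open>y\<close> such that every
  \<open>[n, y(n))\<close> meets many blocks, and to \<open>x\<close> attach its orbit. Both connections are proved by
  contraposition, from points where \<open>y \<le> x\<close>. For the ``infinitely often'' system, almost all points
  are of this kind, in particular almost all points of the orbit; if \<open>[n, y(n))\<close> always meets more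
  than \<open>k\<close> blocks, so do the orbit intervals starting there (\<open>many_blocks_at_orbit_point\<close>). For the
  ``almost always'' system, such points need not lie on the orbit. There \<open>y\<close> is chosen for \<open>2k\<close>
  instead of \<open>k\<close>: two adjacent orbit intervals together meet more than \<open>2k\<close> blocks, so one of
  them meets more than \<open>k\<close> (\<open>many_blocks_near_orbit\<close>).
\<close>

section \<open>Tukey connections and duality\<close>

definition tukey_below :: "('a, 'b) rel_sys \<Rightarrow> ('c, 'd) rel_sys \<Rightarrow> bool" where
  "tukey_below R S \<longleftrightarrow> (\<exists>\<phi> \<psi>. \<phi> ` questions R \<subseteq> questions S \<and> \<psi> ` answers S \<subseteq> answers R \<and>
     (\<forall>x\<in>questions R. \<forall>y\<in>answers S. related S (\<phi> x) y \<longrightarrow> related R x (\<psi> y)))"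

definition dual_sys :: "('a, 'b) rel_sys \<Rightarrow> ('b, 'a) rel_sys" where
  "dual_sys R = \<lparr>questions = answers R, answers = questions R,
     related = (\<lambda>y x. \<not> related R x y)\<rparr>"

lemma unbounded_in_dual: "unbounded_in (dual_sys R) E \<longleftrightarrow> dominating_in R E"
  by (auto simp: unbounded_in_def bounded_in_def dominating_in_def dual_sys_def)

lemma dominating_in_dual: "dominating_in (dual_sys R) F \<longleftrightarrow> unbounded_in R F"
  by (auto simp: unbounded_in_def bounded_in_def dominating_in_def dual_sys_def)

lemma bounding_number_dual: "bounding_number (dual_sys R) = dominating_number R"
  by (simp add: bounding_number_def dominating_number_def unbounded_in_dual)

lemma dominating_number_dual: "dominating_number (dual_sys R) = bounding_number R"
  by (simp add: bounding_number_def dominating_number_def dominating_in_dual)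

lemma tukey_below_dual:
  assumes "tukey_below R S"
  shows "tukey_below (dual_sys S) (dual_sys R)"
proof -
  obtain \<phi> \<psi> where "\<phi> ` questions R \<subseteq> questions S" "\<psi> ` answers S \<subseteq> answers R"
    "\<forall>x\<in>questions R. \<forall>y\<in>answers S. related S (\<phi> x) y \<longrightarrow> related R x (\<psi> y)"
    using assms by (auto simp: tukey_below_def)
  then show ?thesis
    unfolding tukey_below_def by (intro exI[of _ \<psi>] exI[of _ \<phi>]) (auto simp: dual_sys_def)
qed

lemma min_card_mono:
  assumes "T \<noteq> {}" and "\<And>B. B \<in> T \<Longrightarrow> \<exists>A\<in>S. |A| \<le>o |B|"
  shows "min_card S \<le>o min_card T"
proof -
  obtain B where B: "B \<in> T" "min_card T = |B|"
    using min_card_of(1)[OF assms(1)] by blast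
  then obtain A where A: "A \<in> S" "|A| \<le>o |B|"
    using assms(2) by blast
  then have "min_card S \<le>o |A|"
    by (intro min_card_of(2)) auto
  then show ?thesis
    using A(2) B(2) ordLeq_transitive by metis
qed

text \<open>A Tukey connection carries a dominating family of the larger system, via its map on answers,
  to a dominating family of the smaller one.\<close>

lemma dominating_number_mono:
  assumes "tukey_below R S" and "dominating_in S E\<^sub>0"
  shows "dominating_number R \<le>o dominating_number S"
  unfolding dominating_number_def
proof (rule min_card_mono)
  obtain \<phi> \<psi> where \<phi>: "\<phi> ` questions R \<subseteq> questions S" and \<psi>: "\<psi> ` answers S \<subseteq> answers R"
    and rel: "\<forall>x\<in>questions R. \<forall>y\<in>answers S. related S (\<phi> x) y \<longrightarrow> related R x (\<psi> y)"
    using assms(1) by (auto simp: tukey_below_def)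
  show "{E. dominating_in S E} \<noteq> {}" using assms(2) by blast
  fix E assume "E \<in> {E. dominating_in S E}"
  then have E: "E \<subseteq> answers S" "\<forall>x\<in>questions S. \<exists>y\<in>E. related S x y"
    by (auto simp: dominating_in_def)
  have "\<exists>z\<in>\<psi> ` E. related R x z" if x: "x \<in> questions R" for x
  proof -
    have "\<phi> x \<in> questions S" using \<phi> x by blast
    then obtain y where "y \<in> E" "related S (\<phi> x) y" using E(2) by blast
    then show ?thesis using rel x E(1) by blast
  qed
  then have "dominating_in R (\<psi> ` E)"
    using E(1) \<psi> by (auto simp: dominating_in_def)
  then show "\<exists>D\<in>{E. dominating_in R E}. |D| \<le>o |E|"
    using card_of_image by blast
qed

lemma bounding_number_antimono:
  assumes "tukey_below R S" and "unbounded_in R F\<^sub>0"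
  shows "bounding_number S \<le>o bounding_number R"
  using dominating_number_mono[OF tukey_below_dual[OF assms(1)]] assms(2)
  by (simp add: dominating_number_dual dominating_in_dual)

lemma tukey_equivalent_numbers:
  assumes "tukey_below R S" "tukey_below S R"
    and "unbounded_in R F" "unbounded_in S F'" "dominating_in R E" "dominating_in S E'"
  shows "bounding_number R =o bounding_number S" "dominating_number R =o dominating_number S"
  using assms bounding_number_antimono dominating_number_mono ordIso_iff_ordLeq by metis+

section \<open>Orbits and the intervals they cut out\<close>

definition orbit :: "(nat \<Rightarrow> nat) \<Rightarrow> nat \<Rightarrow> nat" where
  "orbit x n = ((Suc \<circ> x) ^^ n) 0"

lemma orbit_0 [simp]: "orbit x 0 = 0"
  by (simp add: orbit_def)

lemma orbit_Suc [simp]: "orbit x (Suc n) = Suc (x (orbit x n))"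
  by (simp add: orbit_def)

lemma strict_mono_orbit:
  assumes "strict_mono x"
  shows "strict_mono (orbit x)"
  using strict_mono_imp_increasing[OF assms] by (simp add: strict_mono_Suc_iff le_imp_less_Suc)

lemma strict_mono_interval_cover:
  fixes a :: "nat \<Rightarrow> nat"
  assumes "strict_mono a" "a 0 = 0"
  obtains i where "a i \<le> m" "m < a (Suc i)"
proof -
  have "m < a (Suc m)"
    using strict_mono_imp_increasing[OF assms(1), of "Suc m"] by simp
  then obtain j where j: "m < a j" "\<forall>i<j. \<not> m < a i"
    using exists_least_iff[of "\<lambda>j. m < a j"] by blast
  with assms(2) obtain i where "j = Suc i" by (cases j) auto
  with j have "a i \<le> m" "m < a (Suc i)" by (simp_all add: not_less)
  then show ?thesis by (rule that)
qed

lemma strict_mono_interval_unique: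
  fixes a :: "nat \<Rightarrow> nat"
  assumes "strict_mono a" "a i \<le> m" "m < a (Suc i)" "a j \<le> m" "m < a (Suc j)"
  shows "i = j"
  using strict_mono_less[OF assms(1), of i "Suc j"] strict_mono_less[OF assms(1), of j "Suc i"]
    assms(2-) by simp

definition orbit_block :: "(nat \<Rightarrow> nat) \<Rightarrow> nat \<Rightarrow> nat set" where
  "orbit_block x i = {orbit x i..<orbit x (Suc i)}"

definition orbit_partition :: "(nat \<Rightarrow> nat) \<Rightarrow> nat set set" where
  "orbit_partition x = range (orbit_block x)"

lemma orbit_block_unique:
  assumes "strict_mono x" "m \<in> orbit_block x i" "m \<in> orbit_block x j"
  shows "i = j"
  using assms strict_mono_interval_unique[OF strict_mono_orbit, of x i m j]
  by (simp add: orbit_block_def)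

lemma orbit_partition_finite_block:
  assumes x: "strict_mono x"
  shows "orbit_partition x \<in> finite_block_partitions"
proof -
  have ne: "orbit x i \<in> orbit_block x i" for i
    using strict_mono_less[OF strict_mono_orbit[OF x], of i "Suc i"] by (simp add: orbit_block_def)
  have "inj (orbit_block x)"
    using orbit_block_unique[OF x] ne by (metis injI)
  then have "infinite (orbit_partition x)"
    unfolding orbit_partition_def by (rule range_inj_infinite)
  moreover have "partition_on UNIV (orbit_partition x)"
    unfolding orbit_partition_def
  proof (rule partition_onI)
    show "\<Union> (range (orbit_block x)) = UNIV"
    proof (intro equalityI subset_UNIV subsetI)
      fix m
      obtain i where "orbit x i \<le> m" "m < orbit x (Suc i)"
        using strict_mono_interval_cover[OF strict_mono_orbit[OF x] orbit_0] .
      then have "m \<in> orbit_block x i" by (simp add: orbit_block_def)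
      then show "m \<in> \<Union> (range (orbit_block x))" by blast
    qed
    show "disjnt p q" if "p \<in> range (orbit_block x)" "q \<in> range (orbit_block x)" "p \<noteq> q" for p q
      using that orbit_block_unique[OF x] unfolding disjnt_iff by blast
    show "{} \<notin> range (orbit_block x)" using ne by (metis empty_iff rangeE)
  qed
  moreover have "\<forall>X\<in>orbit_partition x. finite X"
    by (auto simp: orbit_partition_def orbit_block_def)
  ultimately show ?thesis by (simp add: finite_block_partitions_def)
qed

section \<open>From dominating functions to partitions\<close>

text \<open>If \<open>n\<close> lies in the \<open>i\<close>-th block of the orbit of \<open>y\<close>, then \<open>y(n)\<close> is at most the value of \<open>y\<close> at
  the next cut, which lies below the cut after that. So \<open>[n, y(n))\<close> cannot reach a third block,
  and it contains \<open>[f(n), f(n + 1))\<close> because \<open>n \<le> f(n)\<close>.\<close>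

lemma blocks_met_orbit_partition:
  assumes f: "strict_mono f" and y: "strict_mono y" and le: "f (Suc n) \<le> y n"
  shows "card (blocks_met f (orbit_partition y) n) \<le> 2"
proof -
  obtain i where i: "orbit y i \<le> n" "n < orbit y (Suc i)"
    using strict_mono_interval_cover[OF strict_mono_orbit[OF y] orbit_0] .
  have "n \<le> f n" using strict_mono_imp_increasing[OF f] .
  moreover have "f (Suc n) < orbit y (Suc (Suc i))"
    using le strict_mono_less_eq[OF y, of n "orbit y (Suc i)"] i(2)
    unfolding orbit_Suc[of y "Suc i"] by linarith
  ultimately have sub: "{f n..<f (n + 1)} \<subseteq> orbit_block y i \<union> orbit_block y (Suc i)"
    using i(1) by (auto simp: orbit_block_def simp del: orbit_Suc)
  have "blocks_met f (orbit_partition y) n \<subseteq> {orbit_block y i, orbit_block y (Suc i)}"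
  proof
    fix X assume "X \<in> blocks_met f (orbit_partition y) n"
    then obtain j m where j: "X = orbit_block y j" and m: "m \<in> orbit_block y j" "m \<in> {f n..<f (n + 1)}"
      unfolding blocks_met_def orbit_partition_def by blast
    then have "j = i \<or> j = Suc i" using sub orbit_block_unique[OF y] by blast
    then show "X \<in> {orbit_block y i, orbit_block y (Suc i)}" using j by blast
  qed
  then have "card (blocks_met f (orbit_partition y) n)
      \<le> card {orbit_block y i, orbit_block y (Suc i)}"
    by (intro card_mono) simp_all
  also have "\<dots> \<le> 2" by (simp add: card_insert_if)
  finally show ?thesis .
qed

lemma increasing_shift: "f \<in> increasing_seqs \<Longrightarrow> f \<circ> Suc \<in> increasing_seqs"
  by (simp add: increasing_seqs_def strict_mono_def)

lemma col_all_below_dom: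
  assumes "k \<ge> 2"
  shows "tukey_below (col_all_sys k) dom_sys"
  unfolding tukey_below_def
proof (intro exI[of _ "\<lambda>f. f \<circ> Suc"] exI[of _ orbit_partition] conjI ballI impI)
  fix f y assume fy: "f \<in> questions (col_all_sys k)" "y \<in> answers dom_sys"
    and "related dom_sys (f \<circ> Suc) y"
  then have "\<forall>\<^sub>\<infinity>n. f (Suc n) \<le> y n" by (simp add: dom_sys_def)
  moreover have "card (blocks_met f (orbit_partition y) n) \<le> k" if "f (Suc n) \<le> y n" for n
    using blocks_met_orbit_partition[of f y n] that fy assms
    by (simp add: col_all_sys_def dom_sys_def increasing_seqs_def)
  ultimately show "related (col_all_sys k) f (orbit_partition y)"
    by (auto simp: col_all_sys_def elim: MOST_mono)
qed (auto simp: col_all_sys_def dom_sys_def increasing_shift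
    intro: orbit_partition_finite_block simp: increasing_seqs_def strict_mono_def)

lemma col_ex_below_dual_dom:
  assumes "k \<ge> 2"
  shows "tukey_below (col_ex_sys k) (dual_sys dom_sys)"
  unfolding tukey_below_def
proof (intro exI[of _ "\<lambda>f. f \<circ> Suc"] exI[of _ orbit_partition] conjI ballI impI)
  fix f y assume fy: "f \<in> questions (col_ex_sys k)" "y \<in> answers (dual_sys dom_sys)"
    and "related (dual_sys dom_sys) (f \<circ> Suc) y"
  then have "\<exists>\<^sub>\<infinity>n. f (Suc n) < y n"
    by (simp add: dual_sys_def dom_sys_def not_MOST not_le)
  moreover have "card (blocks_met f (orbit_partition y) n) \<le> k" if "f (Suc n) < y n" for n
    using blocks_met_orbit_partition[of f y n] that fy assms
    by (simp add: col_ex_sys_def dual_sys_def dom_sys_def increasing_seqs_def)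
  ultimately show "related (col_ex_sys k) f (orbit_partition y)"
    by (auto simp: col_ex_sys_def elim: INFM_mono)
qed (auto simp: col_ex_sys_def dual_sys_def dom_sys_def increasing_shift
    intro: orbit_partition_finite_block simp: increasing_seqs_def strict_mono_def)

section \<open>From partitions to dominating functions\<close>

text \<open>The blocks of \<open>P\<close> met by \<open>[n, y(n))\<close> are counted as \<open>{X\<in>P. {n..<y n} \<inter> X \<noteq> {}}\<close>, since \<open>n\<close> and
  \<open>y(n)\<close> are in general not consecutive terms of a given sequence.\<close>

definition spread_function :: "nat \<Rightarrow> nat set set \<Rightarrow> nat \<Rightarrow> nat" where
  "spread_function k P = (SOME y. strict_mono y \<and> (\<forall>n. card {X\<in>P. {n..<y n} \<inter> X \<noteq> {}} > k))"

lemma finite_blocks_meeting: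
  assumes "P \<in> finite_block_partitions"
  shows "finite {X\<in>P. {a..<b} \<inter> X \<noteq> {}}"
  using finite_blocks_met[OF assms, of "\<lambda>n. if n = 0 then a else b" 0] by (simp add: blocks_met_def)

text \<open>If the consecutive intervals of \<open>f\<close> all meet more than \<open>k\<close> blocks, then \<open>y(n) = f(n + 1)\<close> is as
  required, because \<open>n \<le> f(n)\<close>.\<close>

lemma
  assumes P: "P \<in> finite_block_partitions"
  shows strict_mono_spread_function: "strict_mono (spread_function k P)"
    and spread_function_card: "card {X\<in>P. {n..<spread_function k P n} \<inter> X \<noteq> {}} > k"
proof -
  obtain f where f: "strict_mono f" "\<And>n. card (blocks_met f P n) > k"
    using many_blocks[OF P, of k] by (auto simp: increasing_seqs_def)
  have "k < card {X\<in>P. {n..<(f \<circ> Suc) n} \<inter> X \<noteq> {}}" for n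
  proof -
    have "n \<le> f n" using strict_mono_imp_increasing[OF f(1)] .
    then have "{f n..<f (n + 1)} \<subseteq> {n..<(f \<circ> Suc) n}" by auto
    then have "blocks_met f P n \<subseteq> {X\<in>P. {n..<(f \<circ> Suc) n} \<inter> X \<noteq> {}}"
      unfolding blocks_met_def by blast
    then show ?thesis
      using f(2)[of n] card_mono[OF finite_blocks_meeting[OF P]] by (meson less_le_trans)
  qed
  moreover have "strict_mono (f \<circ> Suc)"
    using f(1) by (simp add: strict_mono_def)
  ultimately have "\<exists>y. strict_mono y \<and> (\<forall>n. card {X\<in>P. {n..<y n} \<inter> X \<noteq> {}} > k)"
    by blast
  from someI_ex[OF this]
  show "strict_mono (spread_function k P)" "card {X\<in>P. {n..<spread_function k P n} \<inter> X \<noteq> {}} > k"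
    by (auto simp: spread_function_def)
qed

lemma many_blocks_at_orbit_point:
  assumes P: "P \<in> finite_block_partitions"
    and le: "spread_function k P (orbit x n) \<le> x (orbit x n)"
  shows "card (blocks_met (orbit x) P n) > k"
proof -
  have "{X\<in>P. {orbit x n..<spread_function k P (orbit x n)} \<inter> X \<noteq> {}} \<subseteq> blocks_met (orbit x) P n"
    using le by (fastforce simp: blocks_met_def)
  then show ?thesis
    using spread_function_card[OF P, of k "orbit x n"] card_mono[OF finite_blocks_met[OF P]]
    by (meson less_le_trans)
qed

text \<open>If \<open>m\<close> lies in the \<open>n\<close>-th orbit interval, then \<open>x(m)\<close> lies below the end of the next one, so
  \<open>[m, x(m))\<close> is covered by these two intervals. It meets more than \<open>2k\<close> blocks, and these cannot be
  shared out with at most \<open>k\<close> for each interval.\<close>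

lemma many_blocks_near_orbit:
  assumes P: "P \<in> finite_block_partitions" and x: "strict_mono x"
    and m: "orbit x n \<le> m" "m < orbit x (Suc n)"
    and le: "spread_function (2 * k) P m \<le> x m"
  shows "card (blocks_met (orbit x) P n) > k \<or> card (blocks_met (orbit x) P (Suc n)) > k"
proof -
  let ?B = "blocks_met (orbit x) P n \<union> blocks_met (orbit x) P (Suc n)"
  have "x m < orbit x (Suc (Suc n))"
    using strict_mono_less_eq[OF x, of m "orbit x (Suc n)"] m(2)
    unfolding orbit_Suc[of x "Suc n"] by linarith
  then have sub: "{m..<spread_function (2 * k) P m}
      \<subseteq> {orbit x n..<orbit x (n + 1)} \<union> {orbit x (Suc n)..<orbit x (Suc n + 1)}"
    using le m(1) by (auto simp del: orbit_Suc)
  have "{X\<in>P. {m..<spread_function (2 * k) P m} \<inter> X \<noteq> {}} \<subseteq> ?B"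
    using sub unfolding blocks_met_def by blast
  then have "card {X\<in>P. {m..<spread_function (2 * k) P m} \<inter> X \<noteq> {}} \<le> card ?B"
    by (intro card_mono) (simp_all add: finite_blocks_met[OF P])
  then have "2 * k < card ?B"
    using spread_function_card[OF P, of "2 * k" m] by simp
  then show ?thesis
    using card_Un_le[of "blocks_met (orbit x) P n" "blocks_met (orbit x) P (Suc n)"] by linarith
qed

lemma dom_below_col_all: "tukey_below dom_sys (col_all_sys k)"
  unfolding tukey_below_def
proof (intro exI[of _ orbit] exI[of _ "spread_function (2 * k)"] conjI ballI impI)
  fix x P assume "x \<in> questions dom_sys" "P \<in> answers (col_all_sys k)"
    and rel: "related (col_all_sys k) (orbit x) P"
  then have x: "strict_mono x" and P: "P \<in> finite_block_partitions"
    by (auto simp: dom_sys_def col_all_sys_def increasing_seqs_def)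
  obtain N where N: "\<And>n. n \<ge> N \<Longrightarrow> card (blocks_met (orbit x) P n) \<le> k"
    using rel by (auto simp: col_all_sys_def MOST_nat_le)
  have "x m \<le> spread_function (2 * k) P m" if "m \<ge> orbit x N" for m
  proof (rule ccontr)
    assume gt: "\<not> x m \<le> spread_function (2 * k) P m"
    obtain n where n: "orbit x n \<le> m" "m < orbit x (Suc n)"
      using strict_mono_interval_cover[OF strict_mono_orbit[OF x] orbit_0] .
    then have "N < Suc n"
      using that strict_mono_less[OF strict_mono_orbit[OF x], of N "Suc n"] by linarith
    then show False
      using many_blocks_near_orbit[OF P x n, of k] gt N[of n] N[of "Suc n"] by simp
  qed
  then show "related dom_sys x (spread_function (2 * k) P)"
    by (auto simp: dom_sys_def MOST_nat_le)
qed (auto simp: dom_sys_def col_all_sys_def increasing_seqs_def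
    intro: strict_mono_orbit strict_mono_spread_function)

lemma dual_dom_below_col_ex: "tukey_below (dual_sys dom_sys) (col_ex_sys k)"
  unfolding tukey_below_def
proof (intro exI[of _ orbit] exI[of _ "spread_function k"] conjI ballI impI)
  fix x P assume "x \<in> questions (dual_sys dom_sys)" "P \<in> answers (col_ex_sys k)"
    and rel: "related (col_ex_sys k) (orbit x) P"
  then have x: "strict_mono x" and P: "P \<in> finite_block_partitions"
    by (auto simp: dual_sys_def dom_sys_def col_ex_sys_def increasing_seqs_def)
  have "\<not> (\<forall>\<^sub>\<infinity>m. spread_function k P m \<le> x m)"
  proof
    assume "\<forall>\<^sub>\<infinity>m. spread_function k P m \<le> x m"
    then obtain N where N: "\<And>m. m \<ge> N \<Longrightarrow> spread_function k P m \<le> x m"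
      by (auto simp: MOST_nat_le)
    have "card (blocks_met (orbit x) P n) > k" if "n \<ge> N" for n
      using strict_mono_imp_increasing[OF strict_mono_orbit[OF x], of n] that
      by (intro many_blocks_at_orbit_point[OF P] N) simp
    then show False
      using rel by (auto simp: col_ex_sys_def INFM_nat_le not_le[symmetric])
  qed
  then show "related (dual_sys dom_sys) x (spread_function k P)"
    by (simp add: dual_sys_def dom_sys_def)
qed (auto simp: dual_sys_def dom_sys_def col_ex_sys_def increasing_seqs_def
    intro: strict_mono_orbit strict_mono_spread_function)

section \<open>The four cardinal equalities\<close>

theorem theoremB:
  fixes k :: nat
  assumes "k \<ge> 2"
  shows "bounding_number (col_all_sys k) =o bounding_number dom_sys \<and>
         dominating_number (col_all_sys k) =o dominating_number dom_sys \<and>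
         bounding_number (col_ex_sys k) =o dominating_number dom_sys \<and>
         dominating_number (col_ex_sys k) =o bounding_number dom_sys"
proof -
  have k: "k \<ge> 1" using assms by simp
  note all = tukey_equivalent_numbers[OF col_all_below_dom[OF assms] dom_below_col_all
      col_sys_unbounded(1) dom_sys_unbounded col_sys_dominating(1)[OF k] dom_sys_dominating]
  have "unbounded_in (dual_sys dom_sys) increasing_seqs"
    "dominating_in (dual_sys dom_sys) increasing_seqs"
    using dom_sys_unbounded dom_sys_dominating
    by (simp_all add: unbounded_in_dual dominating_in_dual)
  note ex = tukey_equivalent_numbers[OF col_ex_below_dual_dom[OF assms] dual_dom_below_col_ex
      col_sys_unbounded(2) this(1) col_sys_dominating(2)[OF k] this(2)]
  show ?thesis
    using all ex by (simp add: bounding_number_dual dominating_number_dual)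
qed

end
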